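(* Suppose there is an algorithm which takes as input a Diophantine equation and returns an integer such that, whenever the equation has only finitely many integer solutions, this integer is greater than the number of integer solutions. Then there is an algorithm which takes as input a Diophantine equation and returns an integer such that, whenever the equation has only finitely many integer solutions, this integer is greater than the heights of all integer solutions.
   Context: A Diophantine equation is an equation $D(x_1,\ldots,x_n)=0$ with $D \in \mathbb Z[x_1,\ldots,x_n]$. The height of a rational number $\frac{p}{q}$ written in lowest terms is $\max(|p|,|q|)$ (so the height of an integer $a$ is $|a|$). The height of a rational tuple $(x_1,\ldots,x_n)$ is the maximum of $n$ and the heights of $x_1,\ldots,x_n$. *)

theory Defs
  imports Complex_Main "HOL-Library.Poly_Mapping" "HOL-Library.Nat_Bijection"
begin

datatype recf =
    Zero
  | Succ
  | Proj nat
  | Comp recf "recf list"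
  | PrimRec recf recf
  | Mu recf

text \<open>
  \<open>rec_eval f xs y\<close>: the partial recursive function described by \<open>f\<close> is defined on
  the argument tuple \<open>xs\<close>, with value \<open>y\<close>.  Arities are not tracked; a description applied
  to a tuple of unsuitable length is at worst undefined there, so on tuples of any fixed length
  exactly the usual partial recursive functions are obtained.  The recursion argument and the
  search variable come first.
\<close>

inductive rec_eval :: "recf \<Rightarrow> nat list \<Rightarrow> nat \<Rightarrow> bool" where
  Zero: "rec_eval Zero xs 0"
| Succ: "rec_eval Succ [x] (Suc x)"
| Proj: "i < length xs \<Longrightarrow> rec_eval (Proj i) xs (xs ! i)"
| Comp: "list_all2 (\<lambda>g y. rec_eval g xs y) gs ys \<Longrightarrow> rec_eval f ys z \<Longrightarrow> rec_eval (Comp f gs) xs z"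
| PrimRec_0: "rec_eval f xs y \<Longrightarrow> rec_eval (PrimRec f g) (0 # xs) y"
| PrimRec_Suc: "rec_eval (PrimRec f g) (k # xs) y \<Longrightarrow> rec_eval g (k # y # xs) z \<Longrightarrow>
    rec_eval (PrimRec f g) (Suc k # xs) z"
| Mu: "rec_eval f (k # xs) 0 \<Longrightarrow> (\<And>i. i < k \<Longrightarrow> \<exists>y. y \<noteq> 0 \<and> rec_eval f (i # xs) y) \<Longrightarrow>
    rec_eval (Mu f) xs k"

lemma rec_eval_deterministic:
  "rec_eval f xs y \<Longrightarrow> rec_eval f xs z \<Longrightarrow> y = z"
proof (induction arbitrary: z rule: rec_eval.induct)
  case (Zero xs)
  then show ?case by (auto elim: rec_eval.cases)
next
  case (Succ x)
  then show ?case by (auto elim: rec_eval.cases)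
next
  case (Proj i xs)
  from Proj.prems show ?case by (auto elim: rec_eval.cases)
next
  case (Comp xs gs ys f w)
  from Comp.prems obtain ys' where ys': "list_all2 (\<lambda>g y. rec_eval g xs y) gs ys'" "rec_eval f ys' z"
    by (auto elim: rec_eval.cases)
  have "ys = ys'"
    using Comp.IH(1) ys'(1) by (auto simp: list_all2_conv_all_nth intro!: nth_equalityI)
  with ys'(2) Comp.IH(2) show ?case by blast
next
  case (PrimRec_0 f xs y g)
  from PrimRec_0.prems show ?case
    by (cases rule: rec_eval.cases) (use PrimRec_0.IH in auto)
next
  case (PrimRec_Suc f g k xs y w)
  from PrimRec_Suc.prems show ?case
    by (cases rule: rec_eval.cases) (use PrimRec_Suc.IH in auto)
next
  case (Mu f k xs)
  from Mu.prems obtain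
    z: "rec_eval f (z # xs) 0" "\<And>i. i < z \<Longrightarrow> \<exists>y. y \<noteq> 0 \<and> rec_eval f (i # xs) y"
    by (cases rule: rec_eval.cases) auto
  show ?case
  proof (cases k z rule: linorder_cases)
    case less
    with z(2) Mu.IH(1) show ?thesis by blast
  next
    case greater
    with z(1) Mu.IH(2) show ?thesis by fastforce
  qed simp
qed

text \<open>
  An element of \<open>\<int>[x\<^sub>0, x\<^sub>1, \<dots>]\<close> is a finitely supported map from monomials to coefficients, a
  monomial being a finitely supported map from variable indices to exponents.
\<close>

type_synonym int_mpoly = "(nat \<Rightarrow>\<^sub>0 nat) \<Rightarrow>\<^sub>0 int"

definition int_polys :: "nat \<Rightarrow> int_mpoly set" where
  "int_polys n = {D. \<forall>m \<in> Poly_Mapping.keys D. Poly_Mapping.keys m \<subseteq> {..<n}}"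

definition eval_poly :: "int_mpoly \<Rightarrow> (nat \<Rightarrow> int) \<Rightarrow> int" where
  "eval_poly D x = (\<Sum>m \<in> Poly_Mapping.keys D. Poly_Mapping.lookup D m *
     (\<Prod>i \<in> Poly_Mapping.keys m. x i ^ Poly_Mapping.lookup m i))"

definition int_solutions :: "nat \<Rightarrow> int_mpoly \<Rightarrow> int list set" where
  "int_solutions n D = {x. length x = n \<and> eval_poly D (\<lambda>i. x ! i) = 0}"

definition rat_height :: "rat \<Rightarrow> int" where
  "rat_height r = max \<bar>fst (quotient_of r)\<bar> \<bar>snd (quotient_of r)\<bar>"

text \<open>
  With lowest terms \<open>0 = 0/1\<close> the rational \<open>0\<close> gets height \<open>1\<close>.  This never affects the
  height of a nonempty tuple, which is at least its length.
\<close>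

definition height :: "rat list \<Rightarrow> int" where
  "height x = Max (insert (int (length x)) (rat_height ` set x))"

text \<open>
  A Diophantine equation in \<open>n\<close> variables is given to an algorithm as the number \<open>n\<close> together with
  a written-out sum of terms, each a coefficient with its exponent vector of length \<open>n\<close>.  Terms may
  come in any order and need not be collected, so an equation has many codes.
\<close>

definition poly_of_terms :: "(int \<times> nat list) list \<Rightarrow> int_mpoly" where
  "poly_of_terms ts = (\<Sum>(a, e) \<leftarrow> ts. Poly_Mapping.single (Poly_Mapping.nth e) a)"

definition encode_terms :: "(int \<times> nat list) list \<Rightarrow> nat" where
  "encode_terms ts = list_encode (map (\<lambda>(a, e). prod_encode (int_encode a, list_encode e)) ts)"

definition encodes :: "nat \<Rightarrow> nat \<Rightarrow> int_mpoly \<Rightarrow> bool" where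
  "encodes c n D \<longleftrightarrow>
     (\<exists>ts. (\<forall>(a, e) \<in> set ts. length e = n) \<and> D = poly_of_terms ts \<and>
       c = prod_encode (n, encode_terms ts))"

text \<open>
  \<open>F n D\<close> is the integer returned on the equation \<open>D = 0\<close> in \<open>n\<close> variables.  The algorithm has to
  terminate on every code of every equation, with a result depending only on the equation.
\<close>

definition computable_on_equations :: "(nat \<Rightarrow> int_mpoly \<Rightarrow> int) \<Rightarrow> bool" where
  "computable_on_equations F \<longleftrightarrow>
     (\<exists>A. \<forall>n \<ge> 1. \<forall>D \<in> int_polys n. \<forall>c. encodes c n D \<longrightarrow> rec_eval A [c] (int_encode (F n D)))"

lemma encodes_unique:
  assumes "encodes c n D" "encodes c n' D'"
  shows "n = n' \<and> D = D'"
proof -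
  have "inj (\<lambda>(a, e). prod_encode (int_encode a, list_encode e))"
    by (auto simp: inj_on_def dest: injD[OF inj_int_encode] injD[OF inj_list_encode])
  then have "ts = ts'" if "encode_terms ts = encode_terms ts'" for ts ts'
    using that injD[OF inj_list_encode] unfolding encode_terms_def by (blast dest: map_injective)
  with assms show ?thesis
    unfolding encodes_def by (metis Pair_inject prod_encode_eq)
qed

lemma encodes_int_polys:
  assumes "encodes c n D"
  shows "D \<in> int_polys n"
proof -
  have "poly_of_terms ts \<in> int_polys n" if "\<forall>(a, e) \<in> set ts. length e = n" for ts
    using that
  proof (induction ts)
    case Nil
    then show ?case by (simp add: poly_of_terms_def int_polys_def)
  next
    case (Cons t ts)
    obtain a e where t: "t = (a, e)" by (cases t)
    have "poly_of_terms (t # ts) = Poly_Mapping.single (Poly_Mapping.nth e) a + poly_of_terms ts"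
      by (simp add: poly_of_terms_def t)
    moreover have "Poly_Mapping.keys (Poly_Mapping.nth e) \<subseteq> {..<n}"
      using Cons.prems by (auto simp: t in_set_enumerate_eq)
    moreover have "poly_of_terms ts \<in> int_polys n"
      using Cons by auto
    ultimately show ?case
      using Poly_Mapping.keys_add[of "Poly_Mapping.single (Poly_Mapping.nth e) a" "poly_of_terms ts"]
      unfolding int_polys_def by (fastforce split: if_splits)
  qed
  with assms show ?thesis
    unfolding encodes_def by blast
qed

lemma ex_encodes:
  assumes "D \<in> int_polys n"
  shows "\<exists>c. encodes c n D"
proof -
  obtain ms where ms: "set ms = Poly_Mapping.keys D" "distinct ms"
    using finite_distinct_list[OF finite_keys[of D]] by blast
  define ev :: "(nat \<Rightarrow>\<^sub>0 nat) \<Rightarrow> nat list" where "ev m = map (Poly_Mapping.lookup m) [0..<n]" for m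
  have ev: "Poly_Mapping.nth (ev m) = m" if "m \<in> Poly_Mapping.keys D" for m
  proof (rule poly_mapping_eqI)
    fix i
    have "Poly_Mapping.lookup m i = 0" if "\<not> i < n"
      using assms \<open>m \<in> _\<close> that unfolding int_polys_def by (force simp: in_keys_iff)
    then show "Poly_Mapping.lookup (Poly_Mapping.nth (ev m)) i = Poly_Mapping.lookup m i"
      by (simp add: ev_def nth_default_def)
  qed
  define ts where "ts = map (\<lambda>m. (Poly_Mapping.lookup D m, ev m)) ms"
  have "poly_of_terms ts = (\<Sum>m \<leftarrow> ms. Poly_Mapping.single m (Poly_Mapping.lookup D m))"
    unfolding poly_of_terms_def ts_def map_map o_def prod.case
    by (rule arg_cong[of _ _ sum_list], rule map_cong) (simp_all add: ms(1) ev)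
  also have "\<dots> = (\<Sum>m \<in> Poly_Mapping.keys D. Poly_Mapping.single m (Poly_Mapping.lookup D m))"
    using ms by (simp add: sum_list_distinct_conv_sum_set)
  also have "\<dots> = D"
    by (rule poly_mapping_eqI)
      (auto simp: lookup_sum lookup_single when_def in_keys_iff)
  finally have "D = poly_of_terms ts" ..
  moreover have "\<forall>(a, e) \<in> set ts. length e = n"
    by (auto simp: ts_def ev_def)
  ultimately show ?thesis
    unfolding encodes_def by blast
qed

end

theory Submission
  imports Defs "HOL-Computational_Algebra.Primes"
begin

text \<open>
  Put \<open>S = x\<^sub>0\<^sup>2 + \<dots> + x\<^sub>n\<^sub>-\<^sub>1\<^sup>2 - y\<^sub>0\<^sup>2 - \<dots> - y\<^sub>4\<^sup>2\<close>.  An integer solution of \<open>D\<^sup>2 + S\<^sup>2 = 0\<close> is a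
  solution \<open>x\<close> of \<open>D = 0\<close> with a point \<open>y\<close> of the sphere of squared radius \<open>\<bar>x\<bar>\<^sup>2\<close>.  There are finitely
  many such \<open>y\<close>, but by Lagrange's four-square theorem \<open>y\<^sub>0\<close> can be any of \<open>0, \<dots>, \<bar>x\<^sub>i\<bar>\<close>, so a bound
  on the number of solutions of the new equation bounds the heights of the solutions of the old one.
\<close>

subsection \<open>Lagrange's four-square theorem\<close>

text \<open>The count for \<open>D\<close> alone says nothing about heights, because an equation
  with a single solution may have a huge one. The equation has to be altered so that a tall solution
  is repeated at least as often as its height, while finiteness survives. Points on a sphere do
  both: the squared norm of \<open>x\<close> fixes the radius, so the fibre over each
  \<open>x\<close> is finite, yet it grows with \<open>x\<close>. The number five is one plus four:
  one coordinate is prescribed freely and the other four absorb whatever nonnegative remainder is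
  left. Three would not suffice, since 7 is not a sum of three squares. One sphere serves all
  coordinates of \<open>x\<close> at once. On the algorithmic side the reduction has to act on
  codes: from any code of \<open>D\<close>, in whatever order and with whatever repetition its terms
  are written, a recursive function must produce a code of the new equation.\<close>

definition sum_of_four_squares :: "int \<Rightarrow> bool" where
  "sum_of_four_squares n \<longleftrightarrow> (\<exists>a b c d. n = a^2 + b^2 + c^2 + d^2)"

lemma sum_of_four_squaresI: "n = a^2 + b^2 + c^2 + d^2 \<Longrightarrow> sum_of_four_squares n"
  unfolding sum_of_four_squares_def by blast

text \<open>Multiplicativity of the quaternion norm: the four squares are the coordinates of
  \<open>w + xi + yj + zk\<close> times the conjugate of \<open>a + bi + cj + dk\<close>. Because of
  the conjugate, the last three coordinates vanish when the two quaternions agree; the descent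
  relies on this.\<close>

lemma euler_four_square:
  fixes a b c d w x y z :: "'a::comm_ring_1"
  shows "(a^2 + b^2 + c^2 + d^2) * (w^2 + x^2 + y^2 + z^2) =
    (a*w + b*x + c*y + d*z)^2 + (a*x - b*w + c*z - d*y)^2 +
    (a*y - b*z - c*w + d*x)^2 + (a*z + b*y - c*x - d*w)^2"
  by (simp add: power2_eq_square algebra_simps)

lemma sum_of_four_squares_mult:
  "sum_of_four_squares m \<Longrightarrow> sum_of_four_squares n \<Longrightarrow> sum_of_four_squares (m * n)"
  unfolding sum_of_four_squares_def by (metis euler_four_square)

lemma ex_symmetric_residue:
  fixes a m :: int
  assumes "m > 0"
  shows "\<exists>b k. a = b + m * k \<and> 2 * \<bar>b\<bar> \<le> m"
proof (cases "2 * (a mod m) \<le> m")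
  case True
  with assms show ?thesis
    by (intro exI[of _ "a mod m"] exI[of _ "a div m"]) simp
next
  case False
  have "a mod m < m" using assms by simp
  with False show ?thesis
    by (intro exI[of _ "a mod m - m"] exI[of _ "a div m + 1"]) (simp add: algebra_simps)
qed

text \<open>Reducing the four roots of \<open>m * p\<close> to nearest residues modulo
  \<open>m\<close> gives four squares with sum \<open>m * r\<close>, where \<open>r\<close> is at
  most \<open>m\<close>. Multiplying both sums by the quaternion identity makes every coordinate
  divisible by \<open>m\<close>, and cancelling \<open>m^2\<close> leaves \<open>r * p\<close>. The
  extreme cases 0 and \<open>m\<close> for \<open>r\<close> would force \<open>m\<close> to divide
  the prime \<open>p\<close>.\<close>

lemma four_squares_descent:
  fixes p m :: int
  assumes p: "prime p" and m: "1 < m" "m < p" and sum: "sum_of_four_squares (m * p)"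
  shows "\<exists>r. 0 < r \<and> r < m \<and> sum_of_four_squares (r * p)"
proof -
  obtain a b c d where mp: "m * p = a^2 + b^2 + c^2 + d^2"
    using sum unfolding sum_of_four_squares_def by blast
  have "m > 0" using m by simp
  obtain a' ka where a: "a = a' + m * ka" "2 * \<bar>a'\<bar> \<le> m" using ex_symmetric_residue[OF \<open>m > 0\<close>] by blast
  obtain b' kb where b: "b = b' + m * kb" "2 * \<bar>b'\<bar> \<le> m" using ex_symmetric_residue[OF \<open>m > 0\<close>] by blast
  obtain c' kc where c: "c = c' + m * kc" "2 * \<bar>c'\<bar> \<le> m" using ex_symmetric_residue[OF \<open>m > 0\<close>] by blast
  obtain d' kd where d: "d = d' + m * kd" "2 * \<bar>d'\<bar> \<le> m" using ex_symmetric_residue[OF \<open>m > 0\<close>] by blast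
  \<comment> \<open>Expanding the squares of \<open>a' + m * ka\<close> and its companions turns
    \<open>m * p\<close> into the sum of the reduced squares plus \<open>m * K\<close>.\<close>
  define K where "K = 2 * (a' * ka + b' * kb + c' * kc + d' * kd) + m * (ka^2 + kb^2 + kc^2 + kd^2)"
  define r where "r = p - K"
  have r: "m * r = a'^2 + b'^2 + c'^2 + d'^2"
    using mp unfolding r_def K_def a b c d by (simp add: power2_eq_square algebra_simps)
  have not_dvd: "\<not> m dvd p"
    using p m by (auto simp: prime_int_iff dest!: spec[of _ m])
  have sq_le: "4 * x^2 \<le> m^2" if "2 * \<bar>x\<bar> \<le> m" for x :: int
    using power_mono[OF that, of 2] by (simp add: power_mult_distrib)
  have "m * r \<le> m * m"
    using r sq_le[OF a(2)] sq_le[OF b(2)] sq_le[OF c(2)] sq_le[OF d(2)] by (simp add: power2_eq_square)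
  then have "r \<le> m" using \<open>m > 0\<close> by simp
  have "0 \<le> m * r" unfolding r by simp
  then have "0 \<le> r" using \<open>m > 0\<close> by (simp add: zero_le_mult_iff)
  have "r \<noteq> 0"
  proof
    assume "r = 0"
    with r have "a'^2 + b'^2 + c'^2 + d'^2 = 0" by simp
    then have "a' = 0" "b' = 0" "c' = 0" "d' = 0"
      by (smt (verit) zero_le_power2 power_eq_0_iff)+
    then have "p = m * (ka^2 + kb^2 + kc^2 + kd^2)" using \<open>r = 0\<close> unfolding r_def K_def by simp
    with not_dvd show False by simp
  qed
  moreover have "r \<noteq> m"
  proof
    assume "r = m"
    \<comment> \<open>Four terms, each at most \<open>m^2 / 4\<close>, can sum to \<open>m^2\<close>
      only if all are equal to that bound. So every reduced root is half of \<open>m\<close> in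
      absolute value, and \<open>m\<close> divides its double, which is what occurs in
      \<open>K\<close>.\<close>
    with r have "4 * a'^2 = m^2" "4 * b'^2 = m^2" "4 * c'^2 = m^2" "4 * d'^2 = m^2"
      using sq_le[OF a(2)] sq_le[OF b(2)] sq_le[OF c(2)] sq_le[OF d(2)] by (simp_all add: power2_eq_square)
    moreover have "m dvd 2 * x" if "4 * x^2 = m^2" for x :: int
    proof -
      have "(2 * x)^2 = m^2" using that by (simp add: power_mult_distrib)
      then show ?thesis by (metis dvd_refl pow_divides_pow_iff zero_less_numeral)
    qed
    ultimately have "m dvd 2 * a'" "m dvd 2 * b'" "m dvd 2 * c'" "m dvd 2 * d'" by blast+
    then have "m dvd (2*a') * ka + (2*b') * kb + (2*c') * kc + (2*d') * kd + m * (ka^2 + kb^2 + kc^2 + kd^2)"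
      by (intro dvd_add dvd_mult2[of m "2 * _"] dvd_mult2[OF dvd_refl]) assumption+
    also have "\<dots> = K" unfolding K_def by (simp add: algebra_simps)
    finally have "m dvd r + K" using \<open>r = m\<close> by simp
    with not_dvd show False unfolding r_def by simp
  qed
  moreover have "sum_of_four_squares (r * p)"
  proof -
    \<comment> \<open>The coordinates of the quaternion product divided by \<open>m\<close>. In the
      first, the reduced parts contribute \<open>m * r\<close>, hence the summand \<open>r\<close>;
      in the others the reduced parts cancel.\<close>
    define A where "A = r + ka * a' + kb * b' + kc * c' + kd * d'"
    define B where "B = ka * b' - kb * a' + kc * d' - kd * c'"
    define C where "C = ka * c' - kb * d' - kc * a' + kd * b'"
    define D where "D = ka * d' + kb * c' - kc * b' - kd * a'"
    have "m^2 * (r * p) = (m * p) * (m * r)" by (simp add: power2_eq_square)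
    also have "\<dots> = (a*a' + b*b' + c*c' + d*d')^2 + (a*b' - b*a' + c*d' - d*c')^2 +
        (a*c' - b*d' - c*a' + d*b')^2 + (a*d' + b*c' - c*b' - d*a')^2"
      unfolding mp r by (rule euler_four_square)
    also have "a*a' + b*b' + c*c' + d*d' = m * A"
      using r unfolding A_def a(1) b(1) c(1) d(1) by (simp add: power2_eq_square algebra_simps)
    also have "a*b' - b*a' + c*d' - d*c' = m * B"
      unfolding B_def a(1) b(1) c(1) d(1) by (simp add: algebra_simps)
    also have "a*c' - b*d' - c*a' + d*b' = m * C"
      unfolding C_def a(1) b(1) c(1) d(1) by (simp add: algebra_simps)
    also have "a*d' + b*c' - c*b' - d*a' = m * D"
      unfolding D_def a(1) b(1) c(1) d(1) by (simp add: algebra_simps)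
    finally have "m^2 * (r * p) = m^2 * (A^2 + B^2 + C^2 + D^2)"
      by (simp add: power_mult_distrib algebra_simps)
    then have "r * p = A^2 + B^2 + C^2 + D^2" using \<open>m > 0\<close> by simp
    then show ?thesis by (rule sum_of_four_squaresI)
  qed
  ultimately show ?thesis using \<open>0 \<le> r\<close> \<open>r \<le> m\<close> by force
qed

text \<open>By pigeonhole, the \<open>(p + 1)/2\<close> residues \<open>x\<^sup>2\<close> and the \<open>(p + 1)/2\<close> residues \<open>-1 - y\<^sup>2\<close> meet.\<close>
lemma prime_dvd_sum_two_squares_plus_1:
  fixes p :: int
  assumes p: "prime p" "odd p"
  shows "\<exists>x y. 0 \<le> x \<and> 2 * x < p \<and> 0 \<le> y \<and> 2 * y < p \<and> p dvd x^2 + y^2 + 1"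
proof -
  define h where "h = p div 2"
  have h: "p = 2 * h + 1" using p(2) unfolding h_def by presburger
  have "p > 1" using p(1) by (simp add: prime_int_iff)
  with h have "h > 0" by simp
  define X where "X = {0..h}"
  define f where "f = (\<lambda>x::int. x^2 mod p)"
  define g where "g = (\<lambda>y::int. (-1 - y^2) mod p)"
  have sq_inj: "x = y" if "x \<in> X" "y \<in> X" "p dvd x^2 - y^2" for x y
  proof -
    have "p dvd (x - y) * (x + y)" using that(3) by (simp add: power2_eq_square algebra_simps)
    then consider "p dvd x - y" | "p dvd x + y" using p(1) prime_dvd_multD by blast
    then show ?thesis
    proof cases
      case 1
      have "\<bar>x - y\<bar> < p" using that(1,2) h unfolding X_def by auto
      with 1 show ?thesis by (metis dvd_imp_le_int eq_iff_diff_eq_0 linorder_not_le abs_of_pos \<open>p > 1\<close> less_trans zero_less_one)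
    next
      case 2
      have "0 \<le> x + y" "x + y < p" using that(1,2) h unfolding X_def by auto
      with 2 have "x + y = 0" using zdvd_not_zless[of "x + y" p] by linarith
      with that(1,2) show ?thesis unfolding X_def by auto
    qed
  qed
  have inj_f: "inj_on f X"
    by (rule inj_onI) (auto simp: f_def mod_eq_dvd_iff intro!: sq_inj)
  have inj_g: "inj_on g X"
  proof (rule inj_onI)
    fix x y assume "x \<in> X" "y \<in> X" "g x = g y"
    then have "p dvd y^2 - x^2" unfolding g_def by (simp add: mod_eq_dvd_iff)
    with \<open>x \<in> X\<close> \<open>y \<in> X\<close> show "x = y" using sq_inj[of y x] by simp
  qed
  have "f ` X \<inter> g ` X \<noteq> {}"
  proof
    assume disj: "f ` X \<inter> g ` X = {}"
    have "f ` X \<union> g ` X \<subseteq> {0..<p}" using \<open>p > 1\<close> unfolding f_def g_def by auto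
    then have "card (f ` X \<union> g ` X) \<le> nat p" using card_mono[of "{0..<p}"] by simp
    moreover have "card (f ` X \<union> g ` X) = card X + card X"
      using disj inj_f inj_g by (subst card_Un_disjoint) (auto simp: X_def card_image)
    ultimately show False using h \<open>h > 0\<close> unfolding X_def by simp
  qed
  then obtain x y where xy: "x \<in> X" "y \<in> X" "f x = g y" by blast
  then have "p dvd x^2 - (-1 - y^2)" unfolding f_def g_def by (simp add: mod_eq_dvd_iff)
  then have "p dvd x^2 + y^2 + 1" by (simp add: algebra_simps)
  with xy show ?thesis using h unfolding X_def by (intro exI[of _ x] exI[of _ y]) auto
qed

text \<open>An odd prime has a multiple \<open>m * p\<close> of the form
  \<open>x^2 + y^2 + 1^2 + 0^2\<close> with \<open>0 < m < p\<close>, and the descent lowers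
  \<open>m\<close> until it is 1.\<close>

lemma prime_sum_of_four_squares:
  fixes p :: int
  assumes p: "prime p"
  shows "sum_of_four_squares p"
proof (cases "p = 2")
  case True
  then show ?thesis by (intro sum_of_four_squaresI[of _ 1 1 0 0]) simp
next
  case False
  then have "odd p" using p prime_odd_int[of p] prime_ge_2_int[of p] by simp
  then obtain x y where xy: "0 \<le> x" "2 * x < p" "0 \<le> y" "2 * y < p" "p dvd x^2 + y^2 + 1"
    using prime_dvd_sum_two_squares_plus_1 p by blast
  then obtain m where m: "x^2 + y^2 + 1 = p * m" by blast
  have "p > 1" using p by (simp add: prime_int_iff)
  have "p * m > 0" using m by (smt (verit) zero_le_power2)
  then have "m > 0" using \<open>p > 1\<close> by (simp add: zero_less_mult_iff)
  \<comment> \<open>The residues are at most \<open>(p - 1) / 2\<close>, so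
    \<open>x^2 + y^2 + 1\<close> stays below \<open>p^2\<close>; this is what gives
    \<open>m < p\<close>.\<close>
  have "(2*x)^2 \<le> (p-1)^2" "(2*y)^2 \<le> (p-1)^2" using xy by (intro power_mono; simp)+
  then have "4 * (p * m) \<le> 2 * (p * p) - 4 * p + 6" unfolding m[symmetric] by (simp add: power2_eq_square algebra_simps)
  moreover have "p < p * p" using \<open>p > 1\<close> by simp
  ultimately have "p * m < p * p" using \<open>p > 1\<close> by linarith
  then have "m < p" using \<open>p > 1\<close> by simp
  have "sum_of_four_squares (m * p)"
    using m by (intro sum_of_four_squaresI[of _ x y 1 0]) (simp add: algebra_simps)
  with \<open>m > 0\<close> \<open>m < p\<close> show ?thesis
  proof (induction "nat m" arbitrary: m rule: less_induct)
    case less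
    show ?case
    proof (cases "m = 1")
      case True
      with less.prems show ?thesis by simp
    next
      case False
      with less.prems obtain r where "0 < r" "r < m" "sum_of_four_squares (r * p)"
        using four_squares_descent[OF p, of m] by force
      with less show ?thesis by simp
    qed
  qed
qed

theorem lagrange_four_squares:
  "sum_of_four_squares (int n)"
proof (induction n rule: prime_divisors_induct)
  case zero
  show ?case by (intro sum_of_four_squaresI[of _ 0 0 0 0]) simp
next
  case (unit n)
  then show ?case by (intro sum_of_four_squaresI[of _ 1 0 0 0]) simp
next
  case (factor p n)
  then show ?case by (simp add: sum_of_four_squares_mult prime_sum_of_four_squares)
qed

subsection \<open>Total recursive functions\<close>

text \<open>Stated for functions rather than programs, so that a term is shown computable by
  decomposing it with introduction rules and no program is written out. Fixing the arity is
  necessary because descriptions may be undefined on tuples of another length.\<close>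

definition computable :: "nat \<Rightarrow> (nat list \<Rightarrow> nat) \<Rightarrow> bool" where
  "computable k f \<longleftrightarrow> (\<exists>r. \<forall>xs. length xs = k \<longrightarrow> rec_eval r xs (f xs))"

lemma computableI: "(\<And>xs. length xs = k \<Longrightarrow> rec_eval r xs (f xs)) \<Longrightarrow> computable k f"
  unfolding computable_def by blast

lemma computable_cong:
  "computable k f \<Longrightarrow> (\<And>xs. length xs = k \<Longrightarrow> f xs = g xs) \<Longrightarrow> computable k g"
  unfolding computable_def by metis

lemma computable_nth: "i < k \<Longrightarrow> computable k (\<lambda>xs. xs ! i)"
  by (rule computableI[of _ "Proj i"]) (simp add: rec_eval.Proj)

lemma computable_comp:
  assumes "computable (length gs) f" and "\<And>g. g \<in> set gs \<Longrightarrow> computable k g"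
  shows "computable k (\<lambda>xs. f (map (\<lambda>g. g xs) gs))"
proof -
  obtain rf where rf: "\<And>ys. length ys = length gs \<Longrightarrow> rec_eval rf ys (f ys)"
    using assms(1) unfolding computable_def by blast
  obtain rg where rg: "\<And>g xs. g \<in> set gs \<Longrightarrow> length xs = k \<Longrightarrow> rec_eval (rg g) xs (g xs)"
    using assms(2) unfolding computable_def by metis
  show ?thesis
  proof (rule computableI)
    fix xs :: "nat list" assume "length xs = k"
    then show "rec_eval (Comp rf (map rg gs)) xs (f (map (\<lambda>g. g xs) gs))"
      by (intro rec_eval.Comp[OF _ rf]) (auto simp: list_all2_conv_all_nth intro: rg)
  qed
qed

lemma computable_comp1:
  assumes "computable 1 (\<lambda>ys. f (ys ! 0))" "computable k a"
  shows "computable k (\<lambda>xs. f (a xs))"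
  using computable_comp[of "[a]" "\<lambda>ys. f (ys ! 0)" k] assms by simp

lemma computable_comp2:
  assumes "computable 2 (\<lambda>ys. f (ys ! 0) (ys ! 1))" "computable k a" "computable k b"
  shows "computable k (\<lambda>xs. f (a xs) (b xs))"
  using computable_comp[of "[a, b]" "\<lambda>ys. f (ys ! 0) (ys ! 1)" k] assms
  by (auto simp: numeral_2_eq_2)

lemma computable_comp3:
  assumes "computable 3 (\<lambda>ys. f (ys ! 0) (ys ! 1) (ys ! 2))"
    "computable k a" "computable k b" "computable k c"
  shows "computable k (\<lambda>xs. f (a xs) (b xs) (c xs))"
  using computable_comp[of "[a, b, c]" "\<lambda>ys. f (ys ! 0) (ys ! 1) (ys ! 2)" k] assms
  by (auto simp: eval_nat_numeral)

text \<open>Recursion pushes its counter and partial result in front of the parameters. Here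
  \<open>j\<close> such leading values are discarded and one computed argument takes their place, so
  that a function of \<open>Suc k\<close> arguments can be used in that context.\<close>

lemma computable_subst_drop:
  assumes "computable (Suc k) f" "computable (j + k) a"
  shows "computable (j + k) (\<lambda>xs. f (a xs # drop j xs))"
proof -
  have "computable (j + k) (\<lambda>xs. f (map (\<lambda>g. g xs) (a # map (\<lambda>i xs. xs ! (j + i)) [0..<k])))"
    using assms by (intro computable_comp) (auto intro: computable_nth)
  then show ?thesis
  proof (rule computable_cong)
    fix xs :: "nat list" assume "length xs = j + k"
    then have "map (\<lambda>i. xs ! (j + i)) [0..<k] = drop j xs"
      by (intro nth_equalityI) auto
    then show "f (map (\<lambda>g. g xs) (a # map (\<lambda>i xs. xs ! (j + i)) [0..<k])) = f (a xs # drop j xs)"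
      by (simp add: comp_def)
  qed
qed

lemma computable_drop:
  assumes "computable k f"
  shows "computable (j + k) (\<lambda>xs. f (drop j xs))"
proof -
  have "computable (j + k) (\<lambda>xs. f (map (\<lambda>g. g xs) (map (\<lambda>i xs. xs ! (j + i)) [0..<k])))"
    using assms by (intro computable_comp) (auto intro: computable_nth)
  then show ?thesis
  proof (rule computable_cong)
    fix xs :: "nat list" assume "length xs = j + k"
    then have "map (\<lambda>i. xs ! (j + i)) [0..<k] = drop j xs"
      by (intro nth_equalityI) auto
    then show "f (map (\<lambda>g. g xs) (map (\<lambda>i xs. xs ! (j + i)) [0..<k])) = f (drop j xs)"
      by (simp add: comp_def)
  qed
qed

lemma computable_Suc:
  assumes "computable k a"
  shows "computable k (\<lambda>xs. Suc (a xs))"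
proof (rule computable_comp1[where f = "Suc", OF _ assms], rule computableI)
  fix xs :: "nat list" assume "length xs = 1"
  then show "rec_eval recf.Succ xs (Suc (xs ! 0))"
    by (cases xs) (auto intro: rec_eval.Succ)
qed

lemma computable_const: "computable k (\<lambda>xs. c)"
proof (induction c)
  case 0
  show ?case by (rule computableI) (rule rec_eval.Zero)
next
  case (Suc c)
  then show ?case by (rule computable_Suc)
qed

lemma computable_rec_nat:
  assumes b: "computable k b" and h: "computable (Suc (Suc k)) h" and m: "computable k m"
  shows "computable k (\<lambda>xs. rec_nat (b xs) (\<lambda>i a. h (i # a # xs)) (m xs))"
proof -
  obtain rb where rb: "\<And>xs. length xs = k \<Longrightarrow> rec_eval rb xs (b xs)"
    using b unfolding computable_def by blast
  obtain rh where rh: "\<And>xs. length xs = Suc (Suc k) \<Longrightarrow> rec_eval rh xs (h xs)"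
    using h unfolding computable_def by blast
  \<comment> \<open>\<open>PrimRec\<close> expects the number of iterations as a separate first
    argument; the value \<open>m xs\<close> is substituted for it afterwards.\<close>
  define R where "R = (\<lambda>ys. rec_nat (b (drop 1 ys)) (\<lambda>i a. h (i # a # drop 1 ys)) (ys ! 0))"
  have R: "rec_eval (PrimRec rb rh) (n # xs) (R (n # xs))" if "length xs = k" for n xs
  proof (induction n)
    case 0
    have "R (0 # xs) = b xs" by (simp add: R_def)
    then show ?case using rec_eval.PrimRec_0[OF rb[OF that]] by simp
  next
    case (Suc n)
    have "R (Suc n # xs) = h (n # R (n # xs) # xs)" by (simp add: R_def)
    then show ?case using rec_eval.PrimRec_Suc[OF Suc rh] that by simp
  qed
  have "computable (Suc k) R"
  proof (rule computableI)
    fix ys :: "nat list" assume "length ys = Suc k"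
    then show "rec_eval (PrimRec rb rh) ys (R ys)" using R by (cases ys) auto
  qed
  then have "computable (0 + k) (\<lambda>xs. R (m xs # drop 0 xs))"
    using m by (intro computable_subst_drop) simp_all
  then show ?thesis
    by (simp add: R_def)
qed

text \<open>\<open>Mu\<close> needs defined nonzero values below its result, which totality of
  \<open>g\<close> and minimality supply; the existence hypothesis makes the search halt.\<close>

lemma computable_Least:
  assumes g: "computable (Suc k) g" and ex: "\<And>xs. length xs = k \<Longrightarrow> \<exists>i. g (i # xs) = 0"
  shows "computable k (\<lambda>xs. LEAST i. g (i # xs) = 0)"
proof -
  obtain r where r: "\<And>xs. length xs = Suc k \<Longrightarrow> rec_eval r xs (g xs)"
    using g unfolding computable_def by blast
  show ?thesis
  proof (rule computableI)
    fix xs :: "nat list" assume len: "length xs = k"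
    define l where "l = (LEAST i. g (i # xs) = 0)"
    have "g (l # xs) = 0" unfolding l_def using ex[OF len] by (rule LeastI_ex)
    then have "rec_eval r (l # xs) 0" using r[of "l # xs"] len by simp
    moreover have "\<exists>y. y \<noteq> 0 \<and> rec_eval r (i # xs) y" if "i < l" for i
      using not_less_Least[OF that[unfolded l_def]] r[of "i # xs"] len by auto
    ultimately show "rec_eval (Mu r) xs l" by (rule rec_eval.Mu)
  qed
qed

subsection \<open>Arithmetic\<close>

lemma computable_pred:
  assumes "computable k a"
  shows "computable k (\<lambda>xs. a xs - 1)"
proof (rule computable_comp1[where f = "\<lambda>n. n - 1", OF _ assms])
  have *: "rec_nat 0 (\<lambda>i a. i) n = n - 1" for n :: nat
    by (cases n) simp_all
  have "computable 1 (\<lambda>xs. rec_nat 0 (\<lambda>i a. (i # a # xs) ! 0) (xs ! 0))"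
    by (intro computable_rec_nat[where h = "\<lambda>ys. ys ! 0"] computable_const computable_nth) simp_all
  then show "computable 1 (\<lambda>xs. xs ! 0 - 1)" by (simp add: *)
qed

lemma computable_add:
  assumes "computable k a" "computable k b"
  shows "computable k (\<lambda>xs. a xs + b xs)"
proof (rule computable_comp2[where f = "(+)", OF _ assms])
  have *: "rec_nat m (\<lambda>i a. Suc a) n = m + n" for m n :: nat
    by (induction n) simp_all
  have "computable 2 (\<lambda>xs. rec_nat (xs ! 0) (\<lambda>i a. Suc ((i # a # xs) ! 1)) (xs ! 1))"
    by (intro computable_rec_nat[where h = "\<lambda>ys. Suc (ys ! 1)"] computable_Suc computable_nth) simp_all
  then show "computable 2 (\<lambda>xs. xs ! 0 + xs ! 1)" by (simp add: *)
qed

lemma computable_diff: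
  assumes "computable k a" "computable k b"
  shows "computable k (\<lambda>xs. a xs - b xs)"
proof (rule computable_comp2[where f = "(-)", OF _ assms])
  have *: "rec_nat m (\<lambda>i a. a - Suc 0) n = m - n" for m n :: nat
    by (induction n) simp_all
  have "computable 2 (\<lambda>xs. rec_nat (xs ! 0) (\<lambda>i a. (i # a # xs) ! 1 - 1) (xs ! 1))"
    by (intro computable_rec_nat[where h = "\<lambda>ys. ys ! 1 - 1"] computable_pred computable_nth) simp_all
  then show "computable 2 (\<lambda>xs. xs ! 0 - xs ! 1)" by (simp add: *)
qed

lemma computable_mult:
  assumes "computable k a" "computable k b"
  shows "computable k (\<lambda>xs. a xs * b xs)"
proof (rule computable_comp2[where f = "(*)", OF _ assms])
  have *: "rec_nat 0 (\<lambda>i a. a + m) n = m * n" for m n :: nat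
    by (induction n) simp_all
  have "computable 2 (\<lambda>xs. rec_nat 0 (\<lambda>i a. (i # a # xs) ! 1 + (i # a # xs) ! 2) (xs ! 1))"
    by (intro computable_rec_nat[where h = "\<lambda>ys. ys ! 1 + ys ! 2"] computable_add computable_const computable_nth) simp_all
  then show "computable 2 (\<lambda>xs. xs ! 0 * xs ! 1)" by (simp add: *)
qed

lemma computable_less:
  assumes "computable k a" "computable k b"
  shows "computable k (\<lambda>xs. of_bool (a xs < b xs))"
proof -
  have *: "of_bool (m < n) = 1 - (1 - (n - m))" for m n :: nat by simp
  show ?thesis unfolding * by (intro computable_diff computable_const assms)
qed

lemma computable_eq:
  assumes "computable k a" "computable k b"
  shows "computable k (\<lambda>xs. of_bool (a xs = b xs))"
proof -
  have *: "of_bool (m = n) = 1 - ((m - n) + (n - m))" for m n :: nat by simp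
  show ?thesis unfolding * by (intro computable_diff computable_add computable_const assms)
qed

lemma computable_if:
  assumes "computable k (\<lambda>xs. of_bool (P xs))" "computable k a" "computable k b"
  shows "computable k (\<lambda>xs. if P xs then a xs else b xs)"
proof -
  have *: "(if p then m else n) = of_bool p * m + (1 - of_bool p) * n" for p and m n :: nat by simp
  show ?thesis unfolding * by (intro computable_diff computable_add computable_mult computable_const assms)
qed

lemma computable_div:
  assumes "computable k a" "computable k b"
  shows "computable k (\<lambda>xs. a xs div b xs)"
proof (rule computable_comp2[where f = "(div)", OF _ assms])
  \<comment> \<open>The quotient is the least \<open>q\<close> with \<open>m < Suc q * n\<close>.
    The extra factor \<open>n\<close> makes the search stop at 0 when \<open>n = 0\<close>, in
    agreement with \<open>m div 0 = 0\<close>.\<close>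
  have div: "(Suc m - Suc q * n) * n = 0 \<longleftrightarrow> m div n \<le> q" for m n q :: nat
    using less_mult_imp_div_less[of m "Suc q" n] div_less_iff_less_mult[of n m "Suc q"] by (cases "n = 0") auto
  define g where "g = (\<lambda>ys. (Suc (ys ! 1) - Suc (ys ! 0) * (ys ! 2)) * (ys ! 2 :: nat))"
  have "g (q # xs) = (Suc (xs ! 0) - Suc q * (xs ! 1)) * (xs ! 1)" for q xs
    by (simp add: g_def)
  then have g_eq_0: "g (q # xs) = 0 \<longleftrightarrow> xs ! 0 div xs ! 1 \<le> q" for q xs
    by (simp only: div)
  have "computable (Suc 2) g"
    unfolding g_def by (intro computable_mult computable_diff computable_Suc computable_nth) simp_all
  then have "computable 2 (\<lambda>xs. LEAST q. g (q # xs) = 0)"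
    by (rule computable_Least) (auto simp: g_eq_0)
  moreover have "(LEAST q. g (q # xs) = 0) = xs ! 0 div xs ! 1" for xs
    unfolding g_eq_0 by (rule Least_equality) simp_all
  ultimately show "computable 2 (\<lambda>xs. xs ! 0 div xs ! 1)" by (simp only:)
qed

lemma computable_mod:
  assumes "computable k a" "computable k b"
  shows "computable k (\<lambda>xs. a xs mod b xs)"
  unfolding modulo_nat_def by (intro computable_diff computable_mult computable_div assms)

lemma computable_even:
  assumes "computable k a"
  shows "computable k (\<lambda>xs. of_bool (even (a xs)))"
  unfolding even_iff_mod_2_eq_zero by (intro computable_eq computable_mod computable_const assms)

lemmas computable_arith =
  computable_const computable_Suc computable_add computable_diff computable_mult
  computable_div computable_mod computable_less computable_eq computable_even computable_if

section \<open>The Cantor pairing function and its inverse\<close>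

lemma computable_prod_encode:
  assumes "computable k a" "computable k b"
  shows "computable k (\<lambda>xs. prod_encode (a xs, b xs))"
proof -
  have "triangle n = n * Suc n div 2" for n
    unfolding triangle_def by simp
  then show ?thesis
    unfolding prod_encode_def prod.case by (simp only:) (intro computable_arith assms)
qed

text \<open>The code of \<open>(a, b)\<close> is \<open>triangle (a + b) + a\<close>, which lies on
  the diagonal from \<open>triangle (a + b)\<close> up to but excluding
  \<open>triangle (Suc (a + b))\<close>. The diagonal is therefore the least \<open>s\<close> with
  \<open>z < triangle (Suc s)\<close>, written as a vanishing truncated difference to suit unbounded
  search.\<close>

lemma prod_decode_Least:
  defines "s \<equiv> \<lambda>z. LEAST s. Suc z - triangle (Suc s) = 0"
  shows "prod_decode z = (z - triangle (s z), s z - (z - triangle (s z)))"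
proof -
  obtain a b where z: "z = prod_encode (a, b)"
    by (metis prod_decode_inverse surj_pair)
  have mono: "triangle i \<le> triangle j" if "i \<le> j" for i j
    using that by (induction rule: dec_induct) simp_all
  have "s z = a + b"
    unfolding s_def
  proof (rule Least_equality)
    show "Suc z - triangle (Suc (a + b)) = 0"
      by (simp add: z prod_encode_def)
    show "a + b \<le> j" if "Suc z - triangle (Suc j) = 0" for j
    proof (rule ccontr)
      assume "\<not> a + b \<le> j"
      then have "triangle (Suc j) \<le> triangle (a + b)" by (intro mono) simp
      with that show False by (simp add: z prod_encode_def)
    qed
  qed
  then show ?thesis
    by (simp add: z) (simp add: prod_encode_def)
qed

lemma computable_prod_decode:
  assumes "computable k a"
  shows "computable k (\<lambda>xs. fst (prod_decode (a xs)))" "computable k (\<lambda>xs. snd (prod_decode (a xs)))"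
proof -
  have triangle: "triangle n = n * Suc n div 2" for n
    unfolding triangle_def by simp
  have tri: "computable j (\<lambda>xs. triangle (f xs))" if "computable j f" for j f
    unfolding triangle by (intro computable_arith that)
  \<comment> \<open>Since \<open>triangle (Suc z)\<close> is \<open>triangle z + Suc z\<close>, the
    diagonal \<open>z\<close> always bounds the search.\<close>
  have ex: "\<exists>s. Suc z - triangle (Suc s) = 0" for z
    by (rule exI[of _ z]) simp
  have "computable 1 (\<lambda>xs. LEAST s. Suc ((s # xs) ! 1) - triangle (Suc ((s # xs) ! 0)) = 0)"
  proof (rule computable_Least[where g = "\<lambda>ys. Suc (ys ! 1) - triangle (Suc (ys ! 0))"])
    show "computable (Suc 1) (\<lambda>ys. Suc (ys ! 1) - triangle (Suc (ys ! 0)))"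
      by (intro computable_diff computable_Suc tri computable_nth) simp_all
  qed (use ex in auto)
  then have s: "computable k (\<lambda>xs. LEAST s. Suc (a xs) - triangle (Suc s) = 0)"
    using computable_comp1[of "\<lambda>z. LEAST s. Suc z - triangle (Suc s) = 0" k a] assms by simp
  show "computable k (\<lambda>xs. fst (prod_decode (a xs)))" "computable k (\<lambda>xs. snd (prod_decode (a xs)))"
    unfolding prod_decode_Least fst_conv snd_conv by (intro computable_diff tri assms s)+
qed

text \<open>\<open>int_encode\<close> sends \<open>a \<ge> 0\<close> to \<open>2a\<close> and \<open>a < 0\<close> to \<open>2\<bar>a\<bar> - 1\<close>.  When a factor is zero the
  truncated subtraction returns the right code \<open>0\<close> whatever the parities.\<close>
definition code_int_mult :: "nat \<Rightarrow> nat \<Rightarrow> nat" where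
  "code_int_mult p q = 2 * (Suc p div 2 * (Suc q div 2)) - (if even (p + q) then 0 else 1)"

lemma code_int_mult: "code_int_mult (int_encode a) (int_encode b) = int_encode (a * b)"
proof -
  have abs: "Suc (int_encode a) div 2 = nat \<bar>a\<bar>" for a
    by (auto simp: int_encode_def sum_encode_def)
  have even: "even (int_encode a) \<longleftrightarrow> 0 \<le> a" for a
    by (auto simp: int_encode_def sum_encode_def)
  have code: "int_encode c = 2 * nat \<bar>c\<bar> - (if 0 \<le> c then 0 else 1)" for c
    by (auto simp: int_encode_def sum_encode_def)
  have "2 * nat \<bar>a * b\<bar> - (if (0 \<le> a) = (0 \<le> b) then 0 else 1) = int_encode (a * b)"
    by (cases "a * b = 0") (auto simp: code zero_le_mult_iff)
  then show ?thesis
    by (simp add: code_int_mult_def abs even abs_mult nat_mult_distrib)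
qed

lemma computable_int_mult:
  assumes "computable k a" "computable k b"
  shows "computable k (\<lambda>xs. code_int_mult (a xs) (b xs))"
  unfolding code_int_mult_def by (intro computable_arith assms)

subsection \<open>Codes of lists\<close>

text \<open>A nonempty list has code \<open>Suc (prod_encode (x, list_encode xs))\<close>, so the
  second component after a predecessor is the code of the tail. The code 0 of the empty list is a
  fixed point, hence dropping past the end is harmless.\<close>

definition code_drop :: "nat \<Rightarrow> nat \<Rightarrow> nat" where
  "code_drop i c = rec_nat c (\<lambda>_ d. snd (prod_decode (d - 1))) i"

definition code_nth :: "nat \<Rightarrow> nat \<Rightarrow> nat" where
  "code_nth c i = fst (prod_decode (code_drop i c - 1))"

definition code_length :: "nat \<Rightarrow> nat" where
  "code_length c = (LEAST i. code_drop i c = 0)"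

lemma prod_decode_0: "prod_decode 0 = (0, 0)"
  using prod_encode_inverse[of "(0, 0)"] by (simp add: prod_encode_def)

lemma code_drop: "code_drop i (list_encode xs) = list_encode (drop i xs)"
proof (induction i)
  case 0
  show ?case by (simp add: code_drop_def)
next
  case (Suc i)
  have "snd (prod_decode (list_encode ys - 1)) = list_encode (tl ys)" for ys
    by (cases ys) (simp_all add: prod_decode_0)
  then show ?case
    using Suc by (simp add: code_drop_def drop_Suc drop_tl)
qed

text \<open>The default 0 past the end matters: it pads exponent vectors when variables are
  added.\<close>

lemma code_nth: "code_nth (list_encode xs) i = nth_default 0 xs i"
proof (cases "i < length xs")
  case True
  then show ?thesis
    by (simp add: code_nth_def code_drop Cons_nth_drop_Suc[symmetric] nth_default_nth)
qed (simp add: code_nth_def code_drop nth_default_beyond prod_decode_0)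

lemma list_encode_eq_0_iff: "list_encode xs = 0 \<longleftrightarrow> xs = []"
  by (cases xs) simp_all

lemma code_length: "code_length (list_encode xs) = length xs"
  by (simp add: code_length_def code_drop list_encode_eq_0_iff Least_equality)

lemma computable_code_drop:
  assumes "computable k a" "computable k b"
  shows "computable k (\<lambda>xs. code_drop (a xs) (b xs))"
proof (rule computable_comp2[where f = "code_drop", OF _ assms])
  have "computable 2 (\<lambda>xs. rec_nat (xs ! 1) (\<lambda>i d. snd (prod_decode ((i # d # xs) ! 1 - 1))) (xs ! 0))"
    by (intro computable_rec_nat[where h = "\<lambda>ys. snd (prod_decode (ys ! 1 - 1))"] computable_prod_decode computable_pred computable_nth) simp_all
  then show "computable 2 (\<lambda>xs. code_drop (xs ! 0) (xs ! 1))"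
    by (simp add: code_drop_def)
qed

lemma computable_code_nth:
  assumes "computable k a" "computable k b"
  shows "computable k (\<lambda>xs. code_nth (a xs) (b xs))"
  unfolding code_nth_def
  by (intro computable_prod_decode computable_pred computable_code_drop assms)

lemma computable_code_length:
  assumes "computable k a"
  shows "computable k (\<lambda>xs. code_length (a xs))"
proof (rule computable_comp1[where f = "code_length", OF _ assms])
  have "computable 1 (\<lambda>xs. LEAST i. code_drop ((i # xs) ! 0) ((i # xs) ! 1) = 0)"
  proof (rule computable_Least[where g = "\<lambda>ys. code_drop (ys ! 0) (ys ! 1)"])
    show "computable (Suc 1) (\<lambda>ys. code_drop (ys ! 0) (ys ! 1))"
      by (intro computable_code_drop computable_nth) simp_all
    \<comment> \<open>The search must halt on every number; as \<open>list_encode\<close> is onto,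
      every number is the code of a list.\<close>
    have "code_drop (length (list_decode c)) c = 0" for c
      using code_drop[of "length (list_decode c)" "list_decode c"] by simp
    then show "\<exists>i. code_drop ((i # xs) ! 0) ((i # xs) ! 1) = 0" for xs by auto
  qed
  then show "computable 1 (\<lambda>xs. code_length (xs ! 0))"
    by (simp add: code_length_def)
qed

definition code_map_upt :: "(nat \<Rightarrow> nat) \<Rightarrow> nat \<Rightarrow> nat" where
  "code_map_upt f n = list_encode (map f [0..<n])"

text \<open>List comprehension over an initial segment, from which the products, squares,
  concatenations and sphere terms on codes are all built. A list code grows at the head, so the
  recursion works backwards and step \<open>i\<close> prepends the entry with index
  \<open>n - Suc i\<close>.\<close>

lemma computable_map_upt:
  assumes g: "computable (Suc k) g" and n: "computable k n"
  shows "computable k (\<lambda>xs. code_map_upt (\<lambda>i. g (i # xs)) (n xs))"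
proof -
  have rec: "rec_nat 0 (\<lambda>i d. Suc (prod_encode (f (n - Suc i), d))) m = list_encode (map f [n - m..<n])"
    if "m \<le> n" for f and m n :: nat
    using that
  proof (induction m)
    case (Suc m)
    then have "[n - Suc m..<n] = (n - Suc m) # [n - m..<n]"
      by (simp add: upt_rec[of "n - Suc m"] Suc_diff_Suc)
    with Suc show ?case by simp
  qed simp
  \<comment> \<open>Positions 0 and 1 hold the counter and the code built so far; the parameters
    start at position 2.\<close>
  define h where "h = (\<lambda>ys. Suc (prod_encode (g ((n (drop 2 ys) - Suc (ys ! 0)) # drop 2 ys), ys ! 1)))"
  have "computable (2 + k) h"
    unfolding h_def
    by (intro computable_Suc computable_prod_encode computable_subst_drop computable_diff
      computable_drop computable_nth g n) simp_all
  then have "computable k (\<lambda>xs. rec_nat 0 (\<lambda>i d. h (i # d # xs)) (n xs))"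
    by (intro computable_rec_nat[where h = h] computable_const n) simp_all
  then show ?thesis
    by (simp add: h_def code_map_upt_def rec[where f = "\<lambda>i. g (i # xs)" and m = "n xs" and n = "n xs" for xs])
qed

subsection \<open>Evaluation of polynomials\<close>

definition eval_monom :: "(nat \<Rightarrow>\<^sub>0 nat) \<Rightarrow> (nat \<Rightarrow> int) \<Rightarrow> int" where
  "eval_monom m x = (\<Prod>i \<in> Poly_Mapping.keys m. x i ^ Poly_Mapping.lookup m i)"

lemma eval_monom_superset:
  assumes "finite K" "Poly_Mapping.keys m \<subseteq> K"
  shows "eval_monom m x = (\<Prod>i \<in> K. x i ^ Poly_Mapping.lookup m i)"
  unfolding eval_monom_def using assms
  by (intro prod.mono_neutral_left) (auto simp: in_keys_iff)

lemma eval_monom_add: "eval_monom (m + k) x = eval_monom m x * eval_monom k x"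
proof -
  let ?K = "Poly_Mapping.keys m \<union> Poly_Mapping.keys k"
  have "eval_monom (m + k) x = (\<Prod>i \<in> ?K. x i ^ Poly_Mapping.lookup (m + k) i)"
    by (rule eval_monom_superset) (simp_all add: Poly_Mapping.keys_add)
  also have "\<dots> = (\<Prod>i \<in> ?K. x i ^ Poly_Mapping.lookup m i) * (\<Prod>i \<in> ?K. x i ^ Poly_Mapping.lookup k i)"
    by (simp add: lookup_add power_add prod.distrib)
  also have "\<dots> = eval_monom m x * eval_monom k x"
    by (subst (1 2) eval_monom_superset[of ?K]) auto
  finally show ?thesis .
qed

lemma eval_poly_superset:
  assumes "finite K" "Poly_Mapping.keys D \<subseteq> K"
  shows "eval_poly D x = (\<Sum>m \<in> K. Poly_Mapping.lookup D m * eval_monom m x)"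
  unfolding eval_poly_def eval_monom_def[symmetric] using assms
  by (intro sum.mono_neutral_left) (auto simp: in_keys_iff)

lemma eval_poly_0 [simp]: "eval_poly 0 x = 0"
  by (simp add: eval_poly_def)

lemma eval_poly_single: "eval_poly (Poly_Mapping.single m a) x = a * eval_monom m x"
  by (subst eval_poly_superset[of "{m}"]) (auto simp: lookup_single)

lemma eval_poly_add: "eval_poly (D + E) x = eval_poly D x + eval_poly E x"
proof -
  let ?K = "Poly_Mapping.keys D \<union> Poly_Mapping.keys E"
  have "eval_poly (D + E) x = (\<Sum>m \<in> ?K. Poly_Mapping.lookup (D + E) m * eval_monom m x)"
    by (rule eval_poly_superset) (simp_all add: Poly_Mapping.keys_add)
  also have "\<dots> = (\<Sum>m \<in> ?K. Poly_Mapping.lookup D m * eval_monom m x) +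
      (\<Sum>m \<in> ?K. Poly_Mapping.lookup E m * eval_monom m x)"
    by (simp add: lookup_add distrib_right sum.distrib)
  also have "\<dots> = eval_poly D x + eval_poly E x"
    by (subst (1 2) eval_poly_superset[of ?K]) auto
  finally show ?thesis .
qed

lemma eval_poly_sum: "finite I \<Longrightarrow> eval_poly (\<Sum>i \<in> I. f i) x = (\<Sum>i \<in> I. eval_poly (f i) x)"
  by (induction I rule: finite_induct) (simp_all add: eval_poly_add)

lemma poly_mapping_sum_single:
  "D = (\<Sum>m \<in> Poly_Mapping.keys D. Poly_Mapping.single m (Poly_Mapping.lookup D m))"
  by (rule poly_mapping_eqI) (auto simp: lookup_sum lookup_single when_def in_keys_iff)

text \<open>Both factors are split into single terms, whose products are single terms again, so that
  multiplicativity reduces to \<open>eval_monom_add\<close>.\<close>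

lemma eval_poly_mult: "eval_poly (D * E) x = eval_poly D x * eval_poly E x"
proof -
  have "D * E = (\<Sum>m \<in> Poly_Mapping.keys D. \<Sum>k \<in> Poly_Mapping.keys E.
      Poly_Mapping.single (m + k) (Poly_Mapping.lookup D m * Poly_Mapping.lookup E k))"
    by (subst (1) poly_mapping_sum_single[of D], subst (1) poly_mapping_sum_single[of E])
      (simp only: sum_product mult_single)
  then have "eval_poly (D * E) x = (\<Sum>m \<in> Poly_Mapping.keys D. \<Sum>k \<in> Poly_Mapping.keys E.
      (Poly_Mapping.lookup D m * eval_monom m x) * (Poly_Mapping.lookup E k * eval_monom k x))"
    by (simp add: eval_poly_sum eval_poly_single eval_monom_add algebra_simps)
  also have "\<dots> = eval_poly D x * eval_poly E x"
    unfolding eval_poly_def eval_monom_def[symmetric] by (simp only: sum_product)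
  finally show ?thesis .
qed

lemma eval_poly_cong:
  assumes "D \<in> int_polys n" "\<And>i. i < n \<Longrightarrow> x i = y i"
  shows "eval_poly D x = eval_poly D y"
  using assms unfolding eval_poly_def int_polys_def
  by (intro sum.cong refl arg_cong2[of _ _ _ _ "(*)"] prod.cong) (auto, metis lessThan_iff subsetD)

lemma poly_of_terms_Nil [simp]: "poly_of_terms [] = 0"
  and poly_of_terms_Cons [simp]:
    "poly_of_terms (t # ts) = Poly_Mapping.single (Poly_Mapping.nth (snd t)) (fst t) + poly_of_terms ts"
  and poly_of_terms_append [simp]: "poly_of_terms (ts @ us) = poly_of_terms ts + poly_of_terms us"
  by (simp_all add: poly_of_terms_def case_prod_beta)

lemma eval_monom_nth: "eval_monom (Poly_Mapping.nth e) x = (\<Prod>i < length e. x i ^ (e ! i))"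
proof -
  have "eval_monom (Poly_Mapping.nth e) x = (\<Prod>i < length e. x i ^ Poly_Mapping.lookup (Poly_Mapping.nth e) i)"
    by (rule eval_monom_superset) (auto simp: in_set_enumerate_eq)
  also have "\<dots> = (\<Prod>i < length e. x i ^ (e ! i))"
    by (simp add: nth_default_nth)
  finally show ?thesis .
qed

lemma eval_poly_of_terms:
  "eval_poly (poly_of_terms ts) x = (\<Sum>(a, e) \<leftarrow> ts. a * (\<Prod>i < length e. x i ^ (e ! i)))"
  by (induction ts) (auto simp: eval_poly_add eval_poly_single eval_monom_nth)

subsection \<open>Multiplication of written-out polynomials\<close>

text \<open>Missing exponents count as 0, so terms in \<open>n\<close> variables are multiplied
  directly into terms in \<open>N\<close> variables.\<close>

fun term_mult :: "nat \<Rightarrow> int \<times> nat list \<Rightarrow> int \<times> nat list \<Rightarrow> int \<times> nat list" where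
  "term_mult N (a, e) (b, f) = (a * b, map (\<lambda>i. nth_default 0 e i + nth_default 0 f i) [0..<N])"

text \<open>Like monomials are left uncollected. Codes allow repetitions, so the plain list of
  pairwise products already represents the square.\<close>

definition square_terms :: "nat \<Rightarrow> (int \<times> nat list) list \<Rightarrow> (int \<times> nat list) list" where
  "square_terms N ts = map (\<lambda>(t, u). term_mult N t u) (List.product ts ts)"

lemma single_term_mult:
  assumes "length (snd t) \<le> N" "length (snd u) \<le> N"
  shows "Poly_Mapping.single (Poly_Mapping.nth (snd (term_mult N t u))) (fst (term_mult N t u)) =
    Poly_Mapping.single (Poly_Mapping.nth (snd t)) (fst t) * Poly_Mapping.single (Poly_Mapping.nth (snd u)) (fst u)"
proof -
  obtain a e b f where t: "t = (a, e)" and u: "u = (b, f)" by (metis surj_pair)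
  have "Poly_Mapping.nth (map (\<lambda>i. nth_default 0 e i + nth_default 0 f i) [0..<N]) =
      Poly_Mapping.nth e + Poly_Mapping.nth f"
    using assms by (intro poly_mapping_eqI) (auto simp: t u lookup_add nth_default_def)
  then show ?thesis by (simp add: t u mult_single)
qed

lemma poly_of_square_terms:
  assumes "\<And>t. t \<in> set ts \<Longrightarrow> length (snd t) \<le> N"
  shows "poly_of_terms (square_terms N ts) = poly_of_terms ts * poly_of_terms ts"
proof -
  have row: "poly_of_terms (map (term_mult N t) us) =
      Poly_Mapping.single (Poly_Mapping.nth (snd t)) (fst t) * poly_of_terms us"
    if "t \<in> set ts" "set us \<subseteq> set ts" for t us
    using that by (induction us) (auto simp: single_term_mult assms distrib_left)
  have "poly_of_terms (map (\<lambda>(t, u). term_mult N t u) (List.product us ts)) =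
      poly_of_terms us * poly_of_terms ts" if "set us \<subseteq> set ts" for us
    using that by (induction us) (auto simp: row comp_def distrib_right)
  then show ?thesis by (simp add: square_terms_def)
qed

lemma length_square_terms:
  "t \<in> set (square_terms N ts) \<Longrightarrow> length (snd t) = N"
  by (auto simp: square_terms_def)

subsection \<open>The auxiliary equation\<close>

definition sphere_terms :: "nat \<Rightarrow> (int \<times> nat list) list" where
  "sphere_terms n = map (\<lambda>i. (if i < n then 1 else - 1, map (\<lambda>j. if j = i then 2 else 0) [0..<n + 5])) [0..<n + 5]"

definition sphere_poly :: "nat \<Rightarrow> int_mpoly" where
  "sphere_poly n = poly_of_terms (sphere_terms n)"

lemma eval_sphere_poly:
  "eval_poly (sphere_poly n) x = (\<Sum>i < n. (x i)^2) - (\<Sum>i < 5. (x (n + i))^2)"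
proof -
  have prod: "(\<Prod>j < n + 5. x j ^ (map (\<lambda>j. if j = i then 2 else 0) [0..<n + 5] ! j)) = (x i)^2"
    if "i < n + 5" for i
  proof -
    have "(\<Prod>j < n + 5. x j ^ (map (\<lambda>j. if j = i then 2 else 0) [0..<n + 5] ! j)) =
        (\<Prod>j < n + 5. if j = i then (x j)^2 else 1)"
      by (intro prod.cong) (auto simp del: upt_Suc)
    with that show ?thesis by simp
  qed
  have "eval_poly (sphere_poly n) x =
      (\<Sum>i \<leftarrow> [0..<n + 5]. (if i < n then 1 else - 1) * (x i)^2)"
    unfolding sphere_poly_def eval_poly_of_terms sphere_terms_def map_map comp_def prod.case
    by (intro arg_cong[of _ _ sum_list] map_cong refl) (simp only: length_map length_upt diff_zero prod set_upt atLeastLessThan_iff)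
  also have "\<dots> = (\<Sum>i < n + 5. (if i < n then 1 else - 1) * (x i)^2)"
    by (simp only: interv_sum_list_conv_sum_set_nat set_upt atLeast0LessThan)
  also have "\<dots> = (\<Sum>i < n. (x i)^2) - (\<Sum>i < 5. (x (n + i))^2)"
    by (simp add: eval_nat_numeral)
  finally show ?thesis .
qed

definition sphere_extension :: "nat \<Rightarrow> int_mpoly \<Rightarrow> int_mpoly" where
  "sphere_extension n D = D * D + sphere_poly n * sphere_poly n"

definition norm_sq :: "int list \<Rightarrow> int" where
  "norm_sq x = (\<Sum>a \<leftarrow> x. a^2)"

lemma norm_sq_conv_sum: "norm_sq x = (\<Sum>i < length x. (x ! i)^2)"
  unfolding norm_sq_def by (simp add: sum_list_sum_nth atLeast0LessThan)

lemma square_le_norm_sq: "a \<in> set x \<Longrightarrow> a^2 \<le> norm_sq x"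
  unfolding norm_sq_def by (intro member_le_sum_list) auto

text \<open>Two integer squares have sum 0 only if both are 0, so the conditions on \<open>D\<close>
  and on the sphere separate. As \<open>D\<close> involves only the first \<open>n\<close>
  variables, it does not see \<open>y\<close>, and the fibre over \<open>x\<close> is the whole
  sphere.\<close>

lemma solutions_sphere_extension:
  assumes "D \<in> int_polys n"
  shows "int_solutions (n + 5) (sphere_extension n D) =
    (\<Union>x \<in> int_solutions n D. (\<lambda>y. x @ y) ` {y. length y = 5 \<and> norm_sq y = norm_sq x})"
proof -
  have eval: "eval_poly (sphere_extension n D) (\<lambda>i. (x @ y) ! i) = 0 \<longleftrightarrow>
      eval_poly D (\<lambda>i. x ! i) = 0 \<and> norm_sq y = norm_sq x" if "length x = n" "length y = 5" for x y
  proof -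
    have "eval_poly D (\<lambda>i. (x @ y) ! i) = eval_poly D (\<lambda>i. x ! i)"
      using that by (intro eval_poly_cong[OF assms]) (simp add: nth_append)
    moreover have "eval_poly (sphere_poly n) (\<lambda>i. (x @ y) ! i) = norm_sq x - norm_sq y"
      using that by (simp add: eval_sphere_poly norm_sq_conv_sum nth_append)
    ultimately show ?thesis
      by (auto simp: sphere_extension_def eval_poly_add eval_poly_mult sum_squares_eq_zero_iff)
  qed
  show ?thesis
  proof (intro equalityI subsetI)
    fix z assume z: "z \<in> int_solutions (n + 5) (sphere_extension n D)"
    then have len: "length (take n z) = n" "length (drop n z) = 5"
      by (auto simp: int_solutions_def)
    show "z \<in> (\<Union>x \<in> int_solutions n D. (\<lambda>y. x @ y) ` {y. length y = 5 \<and> norm_sq y = norm_sq x})"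
      using z eval[OF len] len
      by (intro UN_I[of "take n z"] image_eqI[of _ _ "drop n z"]) (auto simp: int_solutions_def)
  next
    fix z assume "z \<in> (\<Union>x \<in> int_solutions n D. (\<lambda>y. x @ y) ` {y. length y = 5 \<and> norm_sq y = norm_sq x})"
    then obtain x y where "x \<in> int_solutions n D" "length y = 5" "norm_sq y = norm_sq x" "z = x @ y"
      by blast
    then show "z \<in> int_solutions (n + 5) (sphere_extension n D)"
      using eval[of x y] by (simp add: int_solutions_def)
  qed
qed

lemma finite_solutions_sphere_extension:
  assumes "D \<in> int_polys n" "finite (int_solutions n D)"
  shows "finite (int_solutions (n + 5) (sphere_extension n D))"
proof -
  have "finite {y. length y = 5 \<and> norm_sq y = N}" for N
  proof (rule finite_subset)
    \<comment> \<open>Integers satisfy \<open>\<bar>a\<bar> \<le> a^2\<close>, so a point of squared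
      norm \<open>N\<close> lies in the box with sides from \<open>-N\<close> to
      \<open>N\<close>.\<close>
    show "{y. length y = 5 \<and> norm_sq y = N} \<subseteq> {y. set y \<subseteq> {- N..N} \<and> length y = 5}"
    proof safe
      fix y and a :: int assume "a \<in> set y"
      then have "a^2 \<le> norm_sq y" by (rule square_le_norm_sq)
      moreover have "\<bar>a\<bar> \<le> a^2"
      proof (cases "a = 0")
        case False
        then have "\<bar>a\<bar> \<le> \<bar>a\<bar>^2" by (intro self_le_power) linarith+
        then show ?thesis by simp
      qed simp
      ultimately have "\<bar>a\<bar> \<le> norm_sq y" by linarith
      then show "a \<in> {- norm_sq y..norm_sq y}" by auto
    qed
  qed (simp add: finite_lists_length_eq)
  with assms show ?thesis
    by (simp add: solutions_sphere_extension)
qed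

lemma card_solutions_sphere_extension:
  assumes "D \<in> int_polys n" "finite (int_solutions n D)" "x \<in> int_solutions n D" "a \<in> set x"
  shows "\<bar>a\<bar> < int (card (int_solutions (n + 5) (sphere_extension n D)))"
proof -
  have "\<exists>y. length y = 4 \<and> norm_sq (t # y) = norm_sq x" if "t \<in> {0..\<bar>a\<bar>}" for t
  proof -
    have "t^2 \<le> a^2" using that power_mono[of t "\<bar>a\<bar>" 2] by simp
    also have "\<dots> \<le> norm_sq x" using assms(4) by (rule square_le_norm_sq)
    finally obtain b c d e where "norm_sq x - t^2 = b^2 + c^2 + d^2 + e^2"
      using lagrange_four_squares[of "nat (norm_sq x - t^2)"] unfolding sum_of_four_squares_def by auto
    then show ?thesis by (intro exI[of _ "[b, c, d, e]"]) (simp add: norm_sq_def)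
  qed
  then obtain y where y: "\<And>t. t \<in> {0..\<bar>a\<bar>} \<Longrightarrow> length (y t) = 4 \<and> norm_sq (t # y t) = norm_sq x"
    by metis
  \<comment> \<open>This interval has \<open>\<bar>a\<bar> + 1\<close> elements, whence the strict
    inequality. Distinct \<open>t\<close> give distinct solutions because \<open>t\<close> itself is
    the coordinate following \<open>x\<close>.\<close>
  have "card {0..\<bar>a\<bar>} \<le> card (int_solutions (n + 5) (sphere_extension n D))"
  proof (rule card_inj_on_le)
    show "inj_on (\<lambda>t. x @ t # y t) {0..\<bar>a\<bar>}" by (rule inj_onI) simp
    show "(\<lambda>t. x @ t # y t) ` {0..\<bar>a\<bar>} \<subseteq> int_solutions (n + 5) (sphere_extension n D)"
      unfolding solutions_sphere_extension[OF assms(1)] using y assms(3) by auto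
  qed (rule finite_solutions_sphere_extension[OF assms(1,2)])
  then show ?thesis by simp
qed

subsection \<open>Computing the code of the auxiliary equation\<close>

definition encode_term :: "int \<times> nat list \<Rightarrow> nat" where
  "encode_term t = prod_encode (int_encode (fst t), list_encode (snd t))"

lemma encode_terms_eq: "encode_terms ts = list_encode (map encode_term ts)"
  by (auto simp: encode_terms_def encode_term_def intro!: arg_cong[of _ _ list_encode])

definition code_term_mult :: "nat \<Rightarrow> nat \<Rightarrow> nat \<Rightarrow> nat" where
  "code_term_mult N p q = prod_encode (code_int_mult (fst (prod_decode p)) (fst (prod_decode q)),
     code_map_upt (\<lambda>i. code_nth (snd (prod_decode p)) i + code_nth (snd (prod_decode q)) i) N)"

lemma code_term_mult: "code_term_mult N (encode_term t) (encode_term u) = encode_term (term_mult N t u)"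
  by (cases t; cases u) (simp add: code_term_mult_def encode_term_def code_int_mult code_nth code_map_upt_def)

lemma computable_term_mult:
  assumes "computable k N" "computable k p" "computable k q"
  shows "computable k (\<lambda>xs. code_term_mult (N xs) (p xs) (q xs))"
proof (rule computable_comp3[where f = code_term_mult, OF _ assms])
  have "computable (Suc 3) (\<lambda>ys. code_nth (snd (prod_decode (ys ! 2))) (ys ! 0) +
      code_nth (snd (prod_decode (ys ! 3))) (ys ! 0))"
    by (intro computable_add computable_code_nth computable_prod_decode computable_nth) simp_all
  then have "computable 3 (\<lambda>xs. code_map_upt (\<lambda>i. code_nth (snd (prod_decode (xs ! 1))) i +
      code_nth (snd (prod_decode (xs ! 2))) i) (xs ! 0))"
    by (drule_tac computable_map_upt[where n = "\<lambda>xs. xs ! 0"]) (simp_all add: computable_nth)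
  then show "computable 3 (\<lambda>xs. code_term_mult (xs ! 0) (xs ! 1) (xs ! 2))"
    unfolding code_term_mult_def
    by (intro computable_prod_encode computable_int_mult computable_prod_decode computable_nth) simp_all
qed

text \<open>\<open>List.product\<close> lists pairs row by row, so its entry \<open>k\<close> pairs
  the entries at the quotient and the remainder of \<open>k\<close> by the length.\<close>

definition code_square :: "nat \<Rightarrow> nat \<Rightarrow> nat" where
  "code_square N c = code_map_upt (\<lambda>k. code_term_mult N
     (code_nth c (k div code_length c)) (code_nth c (k mod code_length c))) (code_length c * code_length c)"

lemma code_square: "code_square N (encode_terms ts) = encode_terms (square_terms N ts)"
proof -
  define L where "L = length ts"
  have nth: "code_nth (encode_terms ts) k = encode_term (ts ! k)" if "k < L" for k
    using that by (simp add: encode_terms_eq code_nth nth_default_nth L_def)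
  have "code_square N (encode_terms ts) = list_encode (map (\<lambda>k. code_term_mult N
      (code_nth (encode_terms ts) (k div L)) (code_nth (encode_terms ts) (k mod L))) [0..<L * L])"
    by (simp add: code_square_def code_map_upt_def encode_terms_eq code_length L_def)
  also have "\<dots> = list_encode (map encode_term (square_terms N ts))"
  proof (intro arg_cong[of _ _ list_encode] nth_equalityI)
    show "length (map (\<lambda>k. code_term_mult N (code_nth (encode_terms ts) (k div L))
        (code_nth (encode_terms ts) (k mod L))) [0..<L * L]) = length (map encode_term (square_terms N ts))"
      by (simp add: square_terms_def L_def)
    fix k assume "k < length (map (\<lambda>k. code_term_mult N (code_nth (encode_terms ts) (k div L))
        (code_nth (encode_terms ts) (k mod L))) [0..<L * L])"
    then have k: "k < L * L" by simp
    then have "L > 0" by (cases L) auto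
    with k have "k div L < L" "k mod L < L" by (simp_all add: less_mult_imp_div_less)
    then show "map (\<lambda>k. code_term_mult N (code_nth (encode_terms ts) (k div L))
        (code_nth (encode_terms ts) (k mod L))) [0..<L * L] ! k = map encode_term (square_terms N ts) ! k"
      using k by (simp add: nth code_term_mult square_terms_def product_nth L_def)
  qed
  finally show ?thesis by (simp add: encode_terms_eq)
qed

lemma computable_square:
  assumes "computable k N" "computable k c"
  shows "computable k (\<lambda>xs. code_square (N xs) (c xs))"
proof (rule computable_comp2[where f = code_square, OF _ assms])
  have "computable (Suc 2) (\<lambda>ys. code_term_mult (ys ! 1)
      (code_nth (ys ! 2) (ys ! 0 div code_length (ys ! 2)))
      (code_nth (ys ! 2) (ys ! 0 mod code_length (ys ! 2))))"
    by (intro computable_term_mult computable_code_nth computable_code_length computable_arith computable_nth)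
      simp_all
  moreover have "computable 2 (\<lambda>xs. code_length (xs ! 1) * code_length (xs ! 1))"
    by (intro computable_mult computable_code_length computable_nth) simp_all
  ultimately show "computable 2 (\<lambda>xs. code_square (xs ! 0) (xs ! 1))"
    unfolding code_square_def by (drule_tac computable_map_upt) simp_all
qed

definition code_append :: "nat \<Rightarrow> nat \<Rightarrow> nat" where
  "code_append c d = code_map_upt
     (\<lambda>k. if k < code_length c then code_nth c k else code_nth d (k - code_length c))
     (code_length c + code_length d)"

lemma code_append: "code_append (list_encode xs) (list_encode ys) = list_encode (xs @ ys)"
  unfolding code_append_def code_map_upt_def code_length code_nth
  by (intro arg_cong[of _ _ list_encode] nth_equalityI) (auto simp: nth_append nth_default_nth)

lemma computable_append:
  assumes "computable k c" "computable k d"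
  shows "computable k (\<lambda>xs. code_append (c xs) (d xs))"
proof (rule computable_comp2[where f = code_append, OF _ assms])
  have "computable (Suc 2) (\<lambda>ys. if ys ! 0 < code_length (ys ! 1) then code_nth (ys ! 1) (ys ! 0)
      else code_nth (ys ! 2) (ys ! 0 - code_length (ys ! 1)))"
    by (intro computable_code_nth computable_code_length computable_arith computable_nth) simp_all
  moreover have "computable 2 (\<lambda>xs. code_length (xs ! 0) + code_length (xs ! 1))"
    by (intro computable_add computable_code_length computable_nth) simp_all
  ultimately show "computable 2 (\<lambda>xs. code_append (xs ! 0) (xs ! 1))"
    unfolding code_append_def by (drule_tac computable_map_upt) (simp_all cong: if_cong)
qed

text \<open>The coefficients 2 and 1 are the integer codes of 1 and -1.\<close>

definition code_sphere_term :: "nat \<Rightarrow> nat \<Rightarrow> nat" where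
  "code_sphere_term n i =
     prod_encode (if i < n then 2 else 1, code_map_upt (\<lambda>j. if j = i then 2 else 0) (n + 5))"

definition code_sphere :: "nat \<Rightarrow> nat" where
  "code_sphere n = code_map_upt (code_sphere_term n) (n + 5)"

lemma code_sphere: "code_sphere n = encode_terms (sphere_terms n)"
proof -
  have "int_encode 1 = 2" "int_encode (- 1) = 1"
    by (simp_all add: int_encode_def sum_encode_def)
  then show ?thesis
    unfolding code_sphere_def code_sphere_term_def encode_terms_eq sphere_terms_def code_map_upt_def encode_term_def
    by (intro arg_cong[of _ _ list_encode]) (auto simp del: upt_Suc)
qed

lemma computable_sphere:
  assumes "computable k n"
  shows "computable k (\<lambda>xs. code_sphere (n xs))"
proof (rule computable_comp1[where f = code_sphere, OF _ assms])
  have "computable (Suc 2) (\<lambda>ys. if ys ! 0 = ys ! 1 then 2 else 0)"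
    by (intro computable_arith computable_nth) simp_all
  moreover have "computable 2 (\<lambda>xs. xs ! 1 + 5)"
    by (intro computable_arith computable_nth) simp_all
  ultimately have "computable 2 (\<lambda>xs. code_map_upt (\<lambda>j. if j = xs ! 0 then 2 else 0) (xs ! 1 + 5))"
    by (drule_tac computable_map_upt) simp_all
  then have "computable (Suc 1) (\<lambda>ys. code_sphere_term (ys ! 1) (ys ! 0))"
    unfolding code_sphere_term_def numeral_2_eq_2 One_nat_def
    by (intro computable_prod_encode computable_if computable_less computable_const computable_nth) simp_all
  moreover have "computable 1 (\<lambda>xs. xs ! 0 + 5)"
    by (intro computable_arith computable_nth) simp_all
  ultimately show "computable 1 (\<lambda>xs. code_sphere (xs ! 0))"
    unfolding code_sphere_def by (drule_tac computable_map_upt) simp_all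
qed

definition code_sphere_extension :: "nat \<Rightarrow> nat" where
  "code_sphere_extension c = (let n = fst (prod_decode c); N = n + 5 in
     prod_encode (N, code_append (code_square N (snd (prod_decode c))) (code_square N (code_sphere n))))"

lemma encodes_sphere_extension:
  assumes "encodes c n D"
  shows "encodes (code_sphere_extension c) (n + 5) (sphere_extension n D)"
proof -
  obtain ts where ts: "\<forall>(a, e) \<in> set ts. length e = n" "D = poly_of_terms ts"
      "c = prod_encode (n, encode_terms ts)"
    using assms unfolding encodes_def by blast
  define us where "us = square_terms (n + 5) ts @ square_terms (n + 5) (sphere_terms n)"
  have "length (snd t) \<le> n + 5" if "t \<in> set ts" for t
    using ts(1) that by (cases t) auto
  moreover have "length (snd t) \<le> n + 5" if "t \<in> set (sphere_terms n)" for t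
    using that by (auto simp: sphere_terms_def)
  ultimately have "sphere_extension n D = poly_of_terms us"
    by (simp add: us_def ts(2) sphere_extension_def sphere_poly_def poly_of_square_terms)
  moreover have "\<forall>(a, e) \<in> set us. length e = n + 5"
    by (auto simp: us_def dest: length_square_terms)
  moreover have "code_sphere_extension c = prod_encode (n + 5, encode_terms us)"
    by (simp add: code_sphere_extension_def ts(3) code_square code_sphere Let_def)
      (simp add: us_def encode_terms_eq code_append)
  ultimately show ?thesis
    unfolding encodes_def by blast
qed

lemma computable_sphere_extension: "computable 1 (\<lambda>xs. code_sphere_extension (xs ! 0))"
  unfolding code_sphere_extension_def Let_def
  by (intro computable_prod_encode computable_append computable_square computable_sphere
    computable_prod_decode computable_add computable_const computable_nth) simp_all

section \<open>From counting solutions of the auxiliary equation to bounding heights\<close>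

lemma rat_height_of_int: "rat_height (of_int a) = max \<bar>a\<bar> 1"
  by (simp add: rat_height_def quotient_of_int)

theorem theorem5:
  assumes "\<exists>F. computable_on_equations F \<and>
    (\<forall>n \<ge> 1. \<forall>D \<in> int_polys n. finite (int_solutions n D) \<longrightarrow>
      F n D > int (card (int_solutions n D)))"
  shows "\<exists>G. computable_on_equations G \<and>
    (\<forall>n \<ge> 1. \<forall>D \<in> int_polys n. finite (int_solutions n D) \<longrightarrow>
      (\<forall>x \<in> int_solutions n D. G n D > height (map of_int x)))"
proof -
  obtain F where F: "computable_on_equations F"
    "\<And>n D. n \<ge> 1 \<Longrightarrow> D \<in> int_polys n \<Longrightarrow> finite (int_solutions n D) \<Longrightarrow>
      int (card (int_solutions n D)) < F n D"
    using assms by blast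
  obtain A where A: "\<And>n D c. n \<ge> 1 \<Longrightarrow> D \<in> int_polys n \<Longrightarrow> encodes c n D \<Longrightarrow>
      rec_eval A [c] (int_encode (F n D))"
    using F(1) unfolding computable_on_equations_def by blast
  \<comment> \<open>The code of the returned integer is used as it stands: a nonnegative integer has
    its double as code, so \<open>v\<close> bounds the value of \<open>F\<close> from above and
    nothing needs decoding. The summand \<open>n + 1\<close> in \<open>G\<close> makes it exceed the
    length of the tuple too.\<close>
  define v where "v n D = int_encode (F (n + 5) (sphere_extension n D))" for n D
  define G where "G n D = int (v n D + n + 1)" for n D
  have code_G: "int_encode (G n D) = 2 * (v n D + n + 1)" for n D
    by (simp add: G_def int_encode_def sum_encode_def)
  obtain B where B: "\<And>c. rec_eval B [c] (code_sphere_extension c)"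
    using computable_sphere_extension unfolding computable_def by (metis One_nat_def length_Cons list.size(3) nth_Cons_0)
  have "computable 2 (\<lambda>xs. 2 * (xs ! 0 + fst (prod_decode (xs ! 1)) + 1))"
    by (intro computable_mult computable_add computable_prod_decode computable_const computable_nth) simp_all
  then obtain C where C: "\<And>xs. length xs = 2 \<Longrightarrow>
      rec_eval C xs (2 * (xs ! 0 + fst (prod_decode (xs ! 1)) + 1))"
    unfolding computable_def by blast
  \<comment> \<open>\<open>Comp A [B]\<close> yields \<open>v n D\<close>, while
    \<open>Proj 0\<close> keeps the original code, from which \<open>C\<close> reads off
    \<open>n\<close>. The result is the same for all codes of \<open>D\<close>, because
    \<open>F\<close> depends only on the new equation.\<close>
  have "rec_eval (Comp C [Comp A [B], Proj 0]) [c] (int_encode (G n D))"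
    if "n \<ge> 1" "D \<in> int_polys n" "encodes c n D" for n D c
  proof -
    have "fst (prod_decode c) = n" using that(3) by (auto simp: encodes_def)
    then have "rec_eval C [v n D, c] (int_encode (G n D))" using C[of "[v n D, c]"] by (simp add: code_G)
    moreover have "encodes (code_sphere_extension c) (n + 5) (sphere_extension n D)"
      using that(3) by (rule encodes_sphere_extension)
    \<comment> \<open>\<open>A\<close> halts on every code of an equation, so the program halts also
      when \<open>D\<close> has infinitely many solutions.\<close>
    then have "rec_eval A [code_sphere_extension c] (v n D)"
      unfolding v_def by (intro A) (auto dest: encodes_int_polys)
    then have "rec_eval (Comp A [B]) [c] (v n D)"
      using B by (auto intro: rec_eval.Comp)
    moreover have "rec_eval (Proj 0) [c] c"
      using rec_eval.Proj[of 0 "[c]"] by simp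
    ultimately show ?thesis
      by (auto intro!: rec_eval.Comp[of _ _ "[v n D, c]"])
  qed
  then have "computable_on_equations G"
    unfolding computable_on_equations_def by blast
  moreover have "height (map of_int x) < G n D"
    if n: "n \<ge> 1" and D: "D \<in> int_polys n" and fin: "finite (int_solutions n D)"
      and x: "x \<in> int_solutions n D" for n D x
  proof -
    let ?E = "sphere_extension n D"
    obtain c where "encodes c n D" using ex_encodes[OF D] by blast
    then have "?E \<in> int_polys (n + 5)"
      by (rule encodes_int_polys[OF encodes_sphere_extension])
    then have card: "int (card (int_solutions (n + 5) ?E)) < F (n + 5) ?E"
      using finite_solutions_sphere_extension[OF D fin] by (intro F(2)) simp_all
    \<comment> \<open>The value of \<open>F\<close> is positive, as it exceeds a cardinality, so its
      code is its double.\<close>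
    then have "F (n + 5) ?E \<le> int (v n D)"
      unfolding v_def by (simp add: int_encode_def sum_encode_def)
    with card have "\<bar>a\<bar> < G n D" if "a \<in> set x" for a
      using card_solutions_sphere_extension[OF D fin x that] by (simp add: G_def)
    moreover have "length x = n" using x by (simp add: int_solutions_def)
    ultimately show ?thesis
      \<comment> \<open>An integer has height at least 1 because of its denominator;
        \<open>n \<ge> 1\<close> ensures that \<open>G\<close> exceeds this as well.\<close>
      using n by (auto simp: height_def rat_height_of_int) (simp_all add: G_def)
  qed
  ultimately show ?thesis by blast
qed

end
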